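(* Let $n\geq 1$, $\mathcal{N}=\{1,\ldots,n\}$, $\lambda>0$, $\phi>1$, $K>0$, and for each $i\in\mathcal{N}$ let $\gamma_i^{\max}>0$, $a_i,c_i,d_i>0$, $b_i>1$ and $\varphi_i(\gamma)=a_i\gamma^{b_i}+c_i\gamma+d_i$. Consider the optimization problem in the variables $u=(u_1,\ldots,u_n)$ and $\gamma=(\gamma_1,\ldots,\gamma_n)$: $$\min\ \sum_{i=1}^{n}\lambda^{-1}u_i\left((\gamma_i-u_i)^{-1}+K\varphi_i(\gamma_i)\right)$$ $$\text{s.t. }\ \sum_{i=1}^{n}u_i=\phi\lambda,\qquad \gamma_i\leq\gamma_i^{\max},\quad 0\leq u_i<\gamma_i\quad (i\in\mathcal{N}),$$ where a node $i$ is also allowed to be inactive, i.e. $u_i=\gamma_i=0$, in which case its term in the cost is $0$. Let $\theta_i$ and $g_i$ ($i\in\mathcal{N}$) be as defined in the context, and suppose that $$\min_{i\in\mathcal{N}}\{\phi K d_i\}<\theta_1\leq\theta_2\leq\cdots\leq\theta_n\leq\theta_{n+1}:=\max_{i\in\mathcal{N}}\{g_i^{-1}(\gamma_i^{\max})\}.$$ Then the optimal scheduling rates $u_i^{\mathrm{opt}}$ and service rates $\gamma_i^{\mathrm{opt}}$ of this problem are $$\gamma_i^{\mathrm{opt}}=\begin{cases} g_i(\theta), & 1\leq i\leq n^{\ast},\\ 0, & n^{\ast}<i\leq n,\end{cases}\qquad u_i^{\mathrm{opt}}=\begin{cases}\gamma_i^{\mathrm{opt}}-\sqrt{\dfrac{\phi\,\gamma_i^{\mathrm{opt}}}{\theta-K\phi\varphi_i(\gamma_i^{\mathrm{opt}})}},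 & 1\leq i\leq n^{\ast},\\ 0, & n^{\ast}<i\leq n,\end{cases}$$ where $$n^{\ast}:=\arg\max_{k\in\mathcal{N}}\left\{\theta_k:\ \sum_{i=1}^{k}\left(g_i(\theta_k)-\frac{1}{\sqrt{K\varphi_i'(g_i(\theta_k))}}\right)\leq\phi\lambda\right\}$$ and $\theta\in(\theta_{n^{\ast}},\theta_{n^{\ast}+1}]$ is such that $\sum_{i=1}^{n}u_i^{\mathrm{opt}}=\phi\lambda$.
   Context: Here $\lambda$ is the arrival rate of requests at a dispatcher, $u_i$ is the rate at which requests are scheduled to computing node $i$, $\gamma_i$ is the service rate of node $i$ (at most $\gamma_i^{\max}$), $\varphi_i$ is the service cost of node $i$, $K$ is a weight, and $\phi>1$ bounds the over-scheduling. The derivative of $\varphi_i$ is $\varphi_i'(\gamma)=a_ib_i\gamma^{b_i-1}+c_i$. Price of a node: for each $i\in\mathcal{N}$, $$\theta_i:=\phi\min_{0<\gamma\leq\gamma_i^{\max}}\{\gamma^{-1}+K\varphi_i(\gamma)\}.$$ The function $g_i$: for $\theta\geq\phi K d_i$, $\gamma=g_i(\theta)$ is the solution $\gamma\in[0,\gamma_i^{\max}]$ of $$K\phi\varphi_i(\gamma)+K\phi\gamma\varphi_i'(\gamma)=\theta .$$ The left side is increasing in $\gamma$ and equals $\phi K d_i$ at $\gamma=0$; at $\gamma=\gamma_i^{\max}$ it takes the value $\theta_i^{\max}:=K\phi\varphi_i(\gamma_i^{\max})+K\phi\gamma_i^{\max}\varphi_i'(\gamma_i^{\max})$. For $\theta\geq\theta_i^{\max}$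 one sets $g_i(\theta):=g_i(\theta_i^{\max})=\gamma_i^{\max}$. The inverse $g_i^{-1}$ is that of $g_i$ on $[\phi K d_i,\theta_i^{\max}]$, so $g_i^{-1}(\gamma_i^{\max})=\theta_i^{\max}$. The $\arg\max$ defining $n^{\ast}$ denotes the index $k$ for which $\theta_k$ is largest among those $k\in\mathcal{N}$ satisfying the displayed inequality. *)

theory Defs
  imports "HOL-Analysis.Analysis"
begin

text \<open>
  Throughout, \<open>\<phi>\<close> is the over-scheduling factor, \<open>K\<close> the weight of the service cost, \<open>lam\<close> the
  arrival rate, \<open>f\<close> the service cost function of a single node (or, with an index, of each node)
  and \<open>\<gamma>max\<close> its maximal service rate.
\<close>

text \<open>The infimum is a minimum for the cost functions considered, since these are continuous
  and nonnegative on \<open>[0, \<gamma>max]\<close> and \<open>inverse \<gamma>\<close> blows up at \<open>0\<close>.\<close>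

definition price :: "real \<Rightarrow> real \<Rightarrow> (real \<Rightarrow> real) \<Rightarrow> real \<Rightarrow> real" where
  "price \<phi> K f \<gamma>max = \<phi> * (INF \<gamma>\<in>{0<..\<gamma>max}. inverse \<gamma> + K * f \<gamma>)"

text \<open>At \<open>\<gamma> = 0\<close> the derivative is multiplied by \<open>0\<close>, so the value \<open>deriv f 0\<close> (which would
  depend on \<open>f\<close> at negative arguments) is irrelevant.\<close>

definition marginal :: "real \<Rightarrow> real \<Rightarrow> (real \<Rightarrow> real) \<Rightarrow> real \<Rightarrow> real" where
  "marginal \<phi> K f \<gamma> = K * \<phi> * f \<gamma> + K * \<phi> * \<gamma> * deriv f \<gamma>"

text \<open>The function \<open>g\<close> of a node; it is meaningful for \<open>\<theta> \<ge> \<phi> * K * f 0\<close> only.\<close>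

definition rate_at :: "real \<Rightarrow> real \<Rightarrow> (real \<Rightarrow> real) \<Rightarrow> real \<Rightarrow> real \<Rightarrow> real" where
  "rate_at \<phi> K f \<gamma>max \<theta> =
     (if \<theta> < marginal \<phi> K f \<gamma>max
      then THE \<gamma>. \<gamma> \<in> {0..\<gamma>max} \<and> marginal \<phi> K f \<gamma> = \<theta>
      else \<gamma>max)"

definition rate_at_inv :: "real \<Rightarrow> real \<Rightarrow> (real \<Rightarrow> real) \<Rightarrow> real \<Rightarrow> real \<Rightarrow> real" where
  "rate_at_inv \<phi> K f \<gamma>max =
     inv_into {\<phi> * K * f 0..marginal \<phi> K f \<gamma>max} (rate_at \<phi> K f \<gamma>max)"

definition feasible ::
  "nat \<Rightarrow> real \<Rightarrow> real \<Rightarrow> (nat \<Rightarrow> real) \<Rightarrow> (nat \<Rightarrow> real) \<times> (nat \<Rightarrow> real) \<Rightarrow> bool" where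
  "feasible n lam \<phi> \<gamma>max = (\<lambda>(u, \<gamma>).
     (\<Sum>i=1..n. u i) = \<phi> * lam \<and>
     (\<forall>i\<in>{1..n}. \<gamma> i \<le> \<gamma>max i \<and> (0 \<le> u i \<and> u i < \<gamma> i \<or> u i = 0 \<and> \<gamma> i = 0)))"

text \<open>For an inactive node, \<open>u i = \<gamma> i = 0\<close>, the factor \<open>u i\<close> makes the term vanish.\<close>

definition total_cost ::
  "nat \<Rightarrow> real \<Rightarrow> real \<Rightarrow> (nat \<Rightarrow> real \<Rightarrow> real) \<Rightarrow> (nat \<Rightarrow> real) \<times> (nat \<Rightarrow> real) \<Rightarrow> real" where
  "total_cost n lam K f = (\<lambda>(u, \<gamma>).
     \<Sum>i=1..n. inverse lam * u i * (inverse (\<gamma> i - u i) + K * f i (\<gamma> i)))"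

definition optimal ::
  "nat \<Rightarrow> real \<Rightarrow> real \<Rightarrow> real \<Rightarrow> (nat \<Rightarrow> real \<Rightarrow> real) \<Rightarrow> (nat \<Rightarrow> real) \<Rightarrow>
   (nat \<Rightarrow> real) \<Rightarrow> (nat \<Rightarrow> real) \<Rightarrow> bool" where
  "optimal n lam \<phi> K f \<gamma>max u \<gamma> \<longleftrightarrow>
     is_arg_min (total_cost n lam K f) (feasible n lam \<phi> \<gamma>max) (u, \<gamma>)"

end

theory Submission
  imports Defs
begin

text \<open>
  The problem separates under Lagrangian duality: with the multiplier \<open>t = \<theta> / \<phi>\<close> of the
  constraint \<open>\<Sum>u\<^sub>i = \<phi> \<lambda>\<close>, it suffices that each node minimizes
  \<open>u (1 / (\<gamma> - u) - m)\<close>, where \<open>m = t - K f \<gamma>\<close>. For fixed \<open>\<gamma>\<close> the minimum over \<open>u\<close> is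
  \<open>- (sqrt (\<gamma> m) - 1)\<^sup>2\<close>, attained at \<open>\<gamma> - u = sqrt (\<gamma> / m)\<close>, if \<open>\<gamma> m > 1\<close>, and \<open>0\<close>, attained
  only at \<open>u = 0\<close>, otherwise. So \<open>\<gamma>\<close> has to maximize \<open>\<gamma> (t - K f \<gamma>)\<close>, whose derivative vanishes
  where the marginal cost is \<open>\<theta>\<close>, that is at \<open>g \<theta>\<close>; the maximum exceeds \<open>1\<close> exactly when \<open>\<theta>\<close>
  exceeds the price of the node. All these minimizers are unique, and so is the global one.
\<close>

section \<open>Minimizing over the scheduling rate at a fixed service rate\<close>

lemma node_cost_eq_square:
  fixes u \<gamma> m :: real
  assumes "0 \<le> u" "u < \<gamma>" "m > 0"
  shows "u * (inverse (\<gamma> - u) - m) =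
    (sqrt (\<gamma> / (\<gamma> - u)) - sqrt ((\<gamma> - u) * m))\<^sup>2 - (sqrt (\<gamma> * m) - 1)\<^sup>2"
proof -
  define s where "s = \<gamma> - u"
  have s: "s > 0" "\<gamma> > 0" using assms by (auto simp: s_def)
  \<comment> \<open>The product of the two roots is free of \<open>s\<close>, so their cross term
    cancels against that of \<open>(sqrt (\<gamma> * m) - 1)\<^sup>2\<close>: this is AM-GM with the
    deficit kept as a square.\<close>
  have "sqrt (\<gamma> / s) * sqrt (s * m) = sqrt (\<gamma> * m)"
    using s by (simp add: real_sqrt_mult[symmetric])
  then have "(sqrt (\<gamma> / s) - sqrt (s * m))\<^sup>2 = \<gamma> / s + s * m - 2 * sqrt (\<gamma> * m)"
    using s assms(3) by (simp add: power2_diff)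
  moreover have "(sqrt (\<gamma> * m) - 1)\<^sup>2 = \<gamma> * m + 1 - 2 * sqrt (\<gamma> * m)"
    using s assms(3) by (simp add: power2_diff)
  moreover have "(\<gamma> - s) * (inverse s - m) = \<gamma> / s + s * m - \<gamma> * m - 1"
    using s by (simp add: field_simps)
  ultimately show ?thesis by (simp add: s_def)
qed

lemma node_cost_ge_square:
  fixes u \<gamma> m :: real
  assumes "0 \<le> u" "u < \<gamma>" "m > 0"
  shows "u * (inverse (\<gamma> - u) - m) \<ge> - (sqrt (\<gamma> * m) - 1)\<^sup>2"
  using node_cost_eq_square[OF assms] by simp

text \<open>The completed square vanishes exactly when its two roots agree, and
  \<open>\<gamma> - u > 0\<close> selects the positive solution of the resulting quadratic
  equation.\<close>

lemma node_cost_eq_min_iff: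
  fixes u \<gamma> m :: real
  assumes "0 \<le> u" "u < \<gamma>" "m > 0"
  shows "u * (inverse (\<gamma> - u) - m) = - (sqrt (\<gamma> * m) - 1)\<^sup>2 \<longleftrightarrow> u = \<gamma> - sqrt (\<gamma> / m)"
proof -
  define s where "s = \<gamma> - u"
  have s: "s > 0" using assms by (auto simp: s_def)
  have "u * (inverse (\<gamma> - u) - m) = - (sqrt (\<gamma> * m) - 1)\<^sup>2 \<longleftrightarrow> \<gamma> / s = s * m"
    using node_cost_eq_square[OF assms] by (simp add: s_def)
  also have "\<dots> \<longleftrightarrow> s\<^sup>2 = \<gamma> / m"
    using s assms(3) by (auto simp: field_simps power2_eq_square)
  also have "\<dots> \<longleftrightarrow> s = sqrt (\<gamma> / m)"
  proof
    assume "s\<^sup>2 = \<gamma> / m"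
    then show "s = sqrt (\<gamma> / m)" using s by (metis less_imp_le real_sqrt_unique)
  next
    assume "s = sqrt (\<gamma> / m)"
    then show "s\<^sup>2 = \<gamma> / m" using assms by simp
  qed
  finally show ?thesis by (auto simp: s_def)
qed

lemma node_cost_pos:
  fixes u \<gamma> m :: real
  assumes "0 < u" "u < \<gamma>" "\<gamma> * m \<le> 1"
  shows "u * (inverse (\<gamma> - u) - m) > 0"
proof -
  have "m \<le> inverse \<gamma>" using assms by (simp add: field_simps)
  also have "\<dots> < inverse (\<gamma> - u)" using assms by (intro less_imp_inverse_less) auto
  finally show ?thesis using assms(1) by simp
qed

text \<open>The part of \<open>feasible\<close> that concerns a single node; only the constraint on
  the sum couples the nodes.\<close>

definition node_feasible :: "real \<Rightarrow> real \<Rightarrow> real \<Rightarrow> bool" where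
  "node_feasible \<gamma>max u \<gamma> \<longleftrightarrow> \<gamma> \<le> \<gamma>max \<and> (0 \<le> u \<and> u < \<gamma> \<or> u = 0 \<and> \<gamma> = 0)"

section \<open>The marginal cost of a node and the service rate it determines\<close>

locale service_node =
  fixes K \<phi> \<gamma>max a b c d :: real and f :: "real \<Rightarrow> real"
  assumes K_pos: "K > 0" and \<phi>_pos: "\<phi> > 0" and \<gamma>max_pos: "\<gamma>max > 0"
    and a_pos: "a > 0" and b_gt_1: "b > 1" and c_pos: "c > 0" and d_pos: "d > 0"
    and f_def: "f = (\<lambda>\<gamma>. a * \<gamma> powr b + c * \<gamma> + d)"
begin

lemma f_has_derivative:
  assumes "\<gamma> > 0"
  shows "(f has_real_derivative a * b * \<gamma> powr (b - 1) + c) (at \<gamma>)"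
  unfolding f_def using assms by (auto intro!: derivative_eq_intros)

lemma continuous_on_f: "continuous_on {0..} f"
  unfolding f_def using b_gt_1 by (intro continuous_intros continuous_on_powr') auto

lemma f_nonneg: "\<gamma> \<ge> 0 \<Longrightarrow> f \<gamma> \<ge> d"
  using a_pos c_pos by (simp add: f_def)

text \<open>The factor \<open>\<gamma>\<close> in front of the derivative raises the exponent
  \<open>b - 1\<close> to \<open>b\<close>. The closed form, valid at 0 as well, replaces
  \<open>deriv\<close> in the monotonicity and intermediate value arguments.\<close>

lemma marginal_eq:
  assumes "\<gamma> \<ge> 0"
  shows "marginal \<phi> K f \<gamma> = K * \<phi> * (a * (1 + b) * \<gamma> powr b + 2 * c * \<gamma> + d)"
proof (cases "\<gamma> = 0")
  case True
  then show ?thesis by (simp add: marginal_def f_def)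
next
  case False
  then have "\<gamma> > 0" using assms by simp
  then have "\<gamma> * deriv f \<gamma> = a * b * \<gamma> powr b + c * \<gamma>"
    using DERIV_imp_deriv[OF f_has_derivative] by (simp add: powr_diff field_simps)
  moreover have "marginal \<phi> K f \<gamma> = K * \<phi> * (f \<gamma> + \<gamma> * deriv f \<gamma>)"
    by (simp add: marginal_def algebra_simps)
  ultimately show ?thesis by (simp add: f_def algebra_simps)
qed

lemma marginal_strict_mono:
  assumes "0 \<le> x" "x < y"
  shows "marginal \<phi> K f x < marginal \<phi> K f y"
proof -
  have "a * (1 + b) * x powr b \<le> a * (1 + b) * y powr b"
    using assms a_pos b_gt_1 by (intro mult_left_mono powr_mono2) auto
  moreover have "2 * c * x < 2 * c * y" using assms c_pos by simp
  ultimately show ?thesis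
    using assms K_pos \<phi>_pos by (simp add: marginal_eq mult_strict_left_mono)
qed

text \<open>The marginal cost starts at \<open>\<phi> * K * d\<close> for
  \<open>\<gamma> = 0\<close>. Below the cap, the intermediate value theorem gives existence and
  strict monotonicity gives uniqueness, so that \<open>THE\<close> is well defined; otherwise the
  rate is saturated at \<open>\<gamma>max\<close>.\<close>

lemma rate_at_cases:
  assumes "\<phi> * K * d \<le> \<theta>"
  obtains "marginal \<phi> K f (rate_at \<phi> K f \<gamma>max \<theta>) = \<theta>" "rate_at \<phi> K f \<gamma>max \<theta> \<in> {0..\<gamma>max}"
  | "marginal \<phi> K f \<gamma>max \<le> \<theta>" "rate_at \<phi> K f \<gamma>max \<theta> = \<gamma>max"
proof (cases "\<theta> < marginal \<phi> K f \<gamma>max")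
  case True
  let ?P = "\<lambda>\<gamma>. \<gamma> \<in> {0..\<gamma>max} \<and> marginal \<phi> K f \<gamma> = \<theta>"
  let ?M = "\<lambda>\<gamma>. K * \<phi> * (a * (1 + b) * \<gamma> powr b + 2 * c * \<gamma> + d)"
  have "continuous_on {0..\<gamma>max} ?M"
    using b_gt_1 by (intro continuous_intros continuous_on_powr') auto
  then obtain x where "0 \<le> x" "x \<le> \<gamma>max" "?M x = \<theta>"
    using IVT'[of ?M 0 \<theta> \<gamma>max] assms True \<gamma>max_pos by (auto simp: marginal_eq mult.commute)
  then have "?P x" by (simp add: marginal_eq)
  moreover have "y = x" if "?P y" for y
    using that \<open>?P x\<close> marginal_strict_mono[of x y] marginal_strict_mono[of y x]
    by (cases x y rule: linorder_cases) auto
  ultimately have "?P (THE \<gamma>. ?P \<gamma>)" by (rule theI)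
  then show ?thesis using True that(1) by (simp add: rate_at_def)
next
  case False
  then show ?thesis using that(2) by (simp add: rate_at_def)
qed

lemma rate_at_bounds:
  assumes "\<phi> * K * d \<le> \<theta>"
  shows "rate_at \<phi> K f \<gamma>max \<theta> \<in> {0..\<gamma>max}"
  using assms by (rule rate_at_cases) (use \<gamma>max_pos in auto)

section \<open>The gain \<open>\<gamma> * m\<close> of a node and its unique maximizer\<close>

definition gain :: "real \<Rightarrow> real \<Rightarrow> real" where
  "gain \<theta> \<gamma> = \<gamma> * (\<theta> / \<phi> - K * f \<gamma>)"

lemma gain_has_derivative:
  assumes "\<gamma> > 0"
  shows "(gain \<theta> has_real_derivative (\<theta> - marginal \<phi> K f \<gamma>) / \<phi>) (at \<gamma>)"
proof -
  have "(gain \<theta> has_real_derivative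
      (\<theta> / \<phi> - K * f \<gamma>) + \<gamma> * (- (K * deriv f \<gamma>))) (at \<gamma>)"
    unfolding gain_def
    using f_has_derivative[OF assms] DERIV_imp_deriv[OF f_has_derivative[OF assms]]
    by (auto intro!: derivative_eq_intros)
  moreover have "(\<theta> / \<phi> - K * f \<gamma>) + \<gamma> * (- (K * deriv f \<gamma>)) = (\<theta> - marginal \<phi> K f \<gamma>) / \<phi>"
    using \<phi>_pos by (simp add: marginal_def field_simps)
  ultimately show ?thesis by simp
qed

text \<open>The gain is continuous up to 0 and differentiable at positive rates, so the mean value
  theorem also covers intervals starting at 0.\<close>

lemma gain_mvt:
  assumes "0 \<le> x" "x < y"
  obtains z where "x < z" "z < y" "gain \<theta> y - gain \<theta> x = (y - x) * ((\<theta> - marginal \<phi> K f z) / \<phi>)"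
proof -
  have "continuous_on {x..y} (gain \<theta>)"
    unfolding gain_def using assms
    by (intro continuous_intros continuous_on_subset[OF continuous_on_f]) auto
  then have "\<exists>l z. x < z \<and> z < y \<and> DERIV (gain \<theta>) z :> l \<and> gain \<theta> y - gain \<theta> x = (y - x) * l"
    using assms by (intro MVT) (auto simp: real_differentiable_def intro!: exI gain_has_derivative)
  then show ?thesis
    using that assms DERIV_unique gain_has_derivative by (metis le_less_trans)
qed

text \<open>The marginal cost is strictly increasing, so the slope of the gain is positive before
  \<open>g \<theta>\<close>, whether saturated or not, and negative after it.\<close>

lemma gain_less_gain_rate_at:
  assumes "\<phi> * K * d \<le> \<theta>" "\<gamma> \<in> {0..\<gamma>max}" "\<gamma> \<noteq> rate_at \<phi> K f \<gamma>max \<theta>"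
  shows "gain \<theta> \<gamma> < gain \<theta> (rate_at \<phi> K f \<gamma>max \<theta>)"
proof -
  let ?g = "rate_at \<phi> K f \<gamma>max \<theta>"
  consider "\<gamma> < ?g" | "?g < \<gamma>" using assms(3) by linarith
  then show ?thesis
  proof cases
    case 1
    obtain z where z: "\<gamma> < z" "z < ?g"
      "gain \<theta> ?g - gain \<theta> \<gamma> = (?g - \<gamma>) * ((\<theta> - marginal \<phi> K f z) / \<phi>)"
      using gain_mvt[of \<gamma> ?g \<theta>] 1 assms(2) by auto
    have "marginal \<phi> K f z < marginal \<phi> K f ?g"
      using z assms(2) by (intro marginal_strict_mono) auto
    also have "\<dots> \<le> \<theta>" using assms(1) by (rule rate_at_cases) auto
    finally have "(?g - \<gamma>) * ((\<theta> - marginal \<phi> K f z) / \<phi>) > 0"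
      using 1 \<phi>_pos by (intro mult_pos_pos) auto
    then show ?thesis using z(3) by linarith
  next
    case 2
    \<comment> \<open>Saturation is impossible here, as there is a rate
      \<open>\<gamma> \<le> \<gamma>max\<close> to the right of \<open>?g\<close>.\<close>
    have g: "marginal \<phi> K f ?g = \<theta>" "0 \<le> ?g"
      using assms(1) by (rule rate_at_cases; use 2 assms(2) in auto)+
    obtain z where z: "?g < z" "z < \<gamma>"
      "gain \<theta> \<gamma> - gain \<theta> ?g = (\<gamma> - ?g) * ((\<theta> - marginal \<phi> K f z) / \<phi>)"
      using gain_mvt[of ?g \<gamma> \<theta>] 2 g by auto
    have "marginal \<phi> K f z > \<theta>" using marginal_strict_mono[of ?g z] z g by auto
    then have "(\<gamma> - ?g) * ((\<theta> - marginal \<phi> K f z) / \<phi>) < 0"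
      using 2 \<phi>_pos by (intro mult_pos_neg) (auto simp: divide_less_0_iff)
    then show ?thesis using z(3) by linarith
  qed
qed

section \<open>The price as the threshold at which a gain above 1 becomes possible\<close>

lemma unit_cost_gt:
  assumes "\<gamma> > 0"
  shows "K * d < inverse \<gamma> + K * f \<gamma>"
proof -
  have "K * d \<le> K * f \<gamma>" using K_pos f_nonneg[of \<gamma>] assms by simp
  moreover have "inverse \<gamma> > 0" using assms by simp
  ultimately show ?thesis by linarith
qed

lemma bdd_below_unit_cost: "bdd_below ((\<lambda>\<gamma>. inverse \<gamma> + K * f \<gamma>) ` {0<..\<gamma>max})"
  using unit_cost_gt by (intro bdd_belowI2[where m = "K * d"]) (auto simp: less_imp_le)

text \<open>This ensures that every \<open>\<theta>\<close> above the price lies in the range where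
  \<open>rate_at\<close> is meaningful.\<close>

lemma price_ge: "\<phi> * K * d \<le> price \<phi> K f \<gamma>max"
proof -
  have "K * d \<le> (INF \<gamma>\<in>{0<..\<gamma>max}. inverse \<gamma> + K * f \<gamma>)"
    using \<gamma>max_pos unit_cost_gt by (intro cINF_greatest) (auto simp: less_imp_le)
  then show ?thesis using \<phi>_pos by (simp add: price_def mult.assoc)
qed

lemma gain_gt_1_iff:
  assumes "\<gamma> > 0"
  shows "gain \<theta> \<gamma> > 1 \<longleftrightarrow> inverse \<gamma> + K * f \<gamma> < \<theta> / \<phi>"
proof -
  have "gain \<theta> \<gamma> > 1 \<longleftrightarrow> inverse \<gamma> < \<theta> / \<phi> - K * f \<gamma>"
    using assms by (simp add: gain_def inverse_eq_divide pos_divide_less_eq mult.commute)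
  then show ?thesis by auto
qed

text \<open>Some rate has unit cost below \<open>\<theta> / \<phi>\<close>, since the infimum does;
  its gain exceeds 1, and the maximizer of the gain does at least as well.\<close>

lemma gain_gt_1_if_price_less:
  assumes "price \<phi> K f \<gamma>max < \<theta>"
  shows "gain \<theta> (rate_at \<phi> K f \<gamma>max \<theta>) > 1"
proof -
  have "(INF \<gamma>\<in>{0<..\<gamma>max}. inverse \<gamma> + K * f \<gamma>) < \<theta> / \<phi>"
    using assms \<phi>_pos by (simp add: price_def field_simps)
  then obtain \<gamma> where \<gamma>: "\<gamma> \<in> {0<..\<gamma>max}" "inverse \<gamma> + K * f \<gamma> < \<theta> / \<phi>"
    using cINF_less_iff[OF _ bdd_below_unit_cost] \<gamma>max_pos by auto
  then have "gain \<theta> \<gamma> > 1" by (simp add: gain_gt_1_iff)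
  then show ?thesis
    using gain_less_gain_rate_at[of \<theta> \<gamma>] \<gamma>(1) price_ge assms by fastforce
qed

lemma gain_le_1_if_price_ge:
  assumes "\<theta> \<le> price \<phi> K f \<gamma>max" "\<gamma> \<in> {0<..\<gamma>max}"
  shows "gain \<theta> \<gamma> \<le> 1"
proof -
  have "\<theta> / \<phi> \<le> (INF \<gamma>\<in>{0<..\<gamma>max}. inverse \<gamma> + K * f \<gamma>)"
    using assms(1) \<phi>_pos by (simp add: price_def field_simps)
  also have "\<dots> \<le> inverse \<gamma> + K * f \<gamma>"
    using bdd_below_unit_cost assms(2) by (rule cINF_lower)
  finally show ?thesis using gain_gt_1_iff[of \<gamma> \<theta>] assms(2) by auto
qed

section \<open>The Lagrangian of a single node, and idle nodes\<close>

definition node_lagrangian :: "real \<Rightarrow> real \<Rightarrow> real \<Rightarrow> real" where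
  "node_lagrangian \<theta> u \<gamma> = u * (inverse (\<gamma> - u) + K * f \<gamma> - \<theta> / \<phi>)"

lemma node_lagrangian_eq:
  "node_lagrangian \<theta> u \<gamma> = u * (inverse (\<gamma> - u) - (\<theta> / \<phi> - K * f \<gamma>))"
  by (simp add: node_lagrangian_def algebra_simps)

lemma node_lagrangian_inactive:
  assumes "\<theta> \<le> price \<phi> K f \<gamma>max" "node_feasible \<gamma>max u \<gamma>" "u \<noteq> 0"
  shows "node_lagrangian \<theta> u \<gamma> > 0"
proof -
  have *: "0 < u" "u < \<gamma>" "\<gamma> \<in> {0<..\<gamma>max}" using assms(2,3) by (auto simp: node_feasible_def)
  then show ?thesis
    using gain_le_1_if_price_ge[OF assms(1) *(3)]
    by (simp add: node_lagrangian_eq node_cost_pos gain_def)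
qed

section \<open>Active nodes: the claimed rates are the unique minimizers\<close>

context
  fixes \<theta> u0 \<gamma>0 :: real
  assumes price_less: "price \<phi> K f \<gamma>max < \<theta>"
    and \<gamma>0: "\<gamma>0 = rate_at \<phi> K f \<gamma>max \<theta>"
    and u0: "u0 = \<gamma>0 - sqrt (\<phi> * \<gamma>0 / (\<theta> - K * \<phi> * f \<gamma>0))"
begin

lemma active_rates:
  shows "\<gamma>0 \<in> {0<..\<gamma>max}" "\<theta> / \<phi> - K * f \<gamma>0 > 0"
    and "u0 = \<gamma>0 - sqrt (\<gamma>0 / (\<theta> / \<phi> - K * f \<gamma>0))" "0 < u0" "u0 < \<gamma>0"
proof -
  define m where "m = \<theta> / \<phi> - K * f \<gamma>0"
  have le: "\<phi> * K * d \<le> \<theta>" using price_ge price_less by linarith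
  have gt: "\<gamma>0 * m > 1" using gain_gt_1_if_price_less[OF price_less] \<gamma>0 by (simp add: gain_def m_def)
  then have "\<gamma>0 \<noteq> 0" by auto
  then show 1: "\<gamma>0 \<in> {0<..\<gamma>max}" using rate_at_bounds[OF le] \<gamma>0 by simp
  have m: "m > 0"
    using gt 1 zero_less_mult_pos[of \<gamma>0 m] by auto
  then show "\<theta> / \<phi> - K * f \<gamma>0 > 0" by (simp add: m_def)
  have "\<theta> - K * \<phi> * f \<gamma>0 = \<phi> * m" using \<phi>_pos by (simp add: m_def field_simps)
  then have u: "u0 = \<gamma>0 - sqrt (\<gamma>0 / m)" using u0 \<phi>_pos by simp
  then show "u0 = \<gamma>0 - sqrt (\<gamma>0 / (\<theta> / \<phi> - K * f \<gamma>0))" by (simp add: m_def)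
  \<comment> \<open>A gain above 1 is exactly what makes the scheduling rate positive:
    \<open>sqrt (\<gamma>0 / m) < \<gamma>0\<close> amounts to
    \<open>\<gamma>0 * m > 1\<close>.\<close>
  have "\<gamma>0 < \<gamma>0 * (\<gamma>0 * m)" using 1 gt by simp
  then have "\<gamma>0 / m < \<gamma>0\<^sup>2" using m by (simp add: pos_divide_less_eq power2_eq_square mult.assoc)
  then have "sqrt (\<gamma>0 / m) < \<gamma>0" using 1 by (intro real_less_lsqrt) auto
  then show "0 < u0" using u by simp
  have "sqrt (\<gamma>0 / m) > 0" using m 1 by simp
  then show "u0 < \<gamma>0" using u by simp
qed

lemma active_node_feasible: "node_feasible \<gamma>max u0 \<gamma>0"
  using active_rates by (auto simp: node_feasible_def)

lemma active_node_lagrangian_eq: "node_lagrangian \<theta> u0 \<gamma>0 = - (sqrt (gain \<theta> \<gamma>0) - 1)\<^sup>2"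
proof -
  have "0 \<le> u0" using active_rates(4) by simp
  from node_cost_eq_min_iff[OF this active_rates(5,2)] show ?thesis
    unfolding node_lagrangian_eq gain_def using active_rates(3) by blast
qed

text \<open>The value at \<open>(u0, \<gamma>0)\<close> is negative, which beats
  \<open>u = 0\<close> and every rate of gain at most 1. Otherwise the excess comes from the
  completed square if \<open>\<gamma> = \<gamma>0\<close>, and from a strictly smaller gain if
  not.\<close>

lemma node_lagrangian_active:
  assumes "node_feasible \<gamma>max u \<gamma>" "(u, \<gamma>) \<noteq> (u0, \<gamma>0)"
  shows "node_lagrangian \<theta> u \<gamma> > node_lagrangian \<theta> u0 \<gamma>0"
proof -
  define P where "P = gain \<theta> \<gamma>0"
  have P: "P > 1" using gain_gt_1_if_price_less[OF price_less] \<gamma>0 by (simp add: P_def)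
  have le: "\<phi> * K * d \<le> \<theta>" using price_ge price_less by linarith
  have L0: "node_lagrangian \<theta> u0 \<gamma>0 = - (sqrt P - 1)\<^sup>2"
    using active_node_lagrangian_eq by (simp add: P_def)
  have neg: "- (sqrt P - 1)\<^sup>2 < 0" using P by simp
  show ?thesis
  proof (cases "u = 0")
    case True
    then show ?thesis using L0 neg by (simp add: node_lagrangian_def)
  next
    case False
    then have u: "0 < u" "u < \<gamma>" "\<gamma> \<in> {0..\<gamma>max}" using assms(1) by (auto simp: node_feasible_def)
    define m where "m = \<theta> / \<phi> - K * f \<gamma>"
    have L: "node_lagrangian \<theta> u \<gamma> = u * (inverse (\<gamma> - u) - m)"
      by (simp add: node_lagrangian_eq m_def)
    have gm: "gain \<theta> \<gamma> = \<gamma> * m" by (simp add: gain_def m_def)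
    show ?thesis
    proof (cases "\<gamma> * m \<le> 1")
      case True
      then show ?thesis using node_cost_pos[of u \<gamma> m] u L L0 neg by linarith
    next
      case False
      then have m: "m > 0" using u zero_less_mult_pos[of \<gamma> m] by auto
      have ge: "node_lagrangian \<theta> u \<gamma> \<ge> - (sqrt (\<gamma> * m) - 1)\<^sup>2"
        using node_cost_ge_square[of u \<gamma> m] u m L by auto
      show ?thesis
      proof (cases "\<gamma> = \<gamma>0")
        case True
        then have "node_lagrangian \<theta> u \<gamma> \<noteq> - (sqrt (\<gamma> * m) - 1)\<^sup>2"
          using node_cost_eq_min_iff[of u \<gamma> m] u m L assms(2) active_rates(3)
          by (auto simp: m_def)
        moreover have "P = \<gamma> * m" using True gm by (simp add: P_def)
        ultimately show ?thesis using ge L0 by simp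
      next
        case False': False
        then have "\<gamma> * m < P"
          using gain_less_gain_rate_at[OF le u(3)] \<gamma>0 by (simp add: P_def gm)
        then have "sqrt (\<gamma> * m) - 1 < sqrt P - 1" by simp
        \<comment> \<open>The case \<open>\<gamma> * m > 1\<close> keeps the base nonnegative, so
          squaring preserves the order.\<close>
        moreover have "0 \<le> sqrt (\<gamma> * m) - 1" using False by simp
        ultimately have "(sqrt (\<gamma> * m) - 1)\<^sup>2 < (sqrt P - 1)\<^sup>2"
          by (intro power_strict_mono) auto
        then show ?thesis using ge L0 by linarith
      qed
    qed
  qed
qed

end

end

section \<open>Summation over the nodes: global optimality and uniqueness\<close>

theorem theorem1:
  fixes n nstar :: nat
    and lam \<phi> K \<theta> :: real
    and \<gamma>max a b c d :: "nat \<Rightarrow> real"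
    and f :: "nat \<Rightarrow> real \<Rightarrow> real"
    and g :: "nat \<Rightarrow> real \<Rightarrow> real"
    and th \<gamma>opt uopt :: "nat \<Rightarrow> real"
  assumes "n \<ge> 1" "lam > 0" "\<phi> > 1" "K > 0"
    and "\<And>i. i \<in> {1..n} \<Longrightarrow> \<gamma>max i > 0"
    and "\<And>i. i \<in> {1..n} \<Longrightarrow> a i > 0"
    and "\<And>i. i \<in> {1..n} \<Longrightarrow> b i > 1"
    and "\<And>i. i \<in> {1..n} \<Longrightarrow> c i > 0"
    and "\<And>i. i \<in> {1..n} \<Longrightarrow> d i > 0"
    and "\<And>i. i \<in> {1..n} \<Longrightarrow> f i = (\<lambda>\<gamma>. a i * \<gamma> powr b i + c i * \<gamma> + d i)"
    and "\<And>i. i \<in> {1..n} \<Longrightarrow> g i = rate_at \<phi> K (f i) (\<gamma>max i)"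
    and "\<And>i. i \<in> {1..n} \<Longrightarrow> th i = price \<phi> K (f i) (\<gamma>max i)"
    and "th (n + 1) = Max ((\<lambda>i. rate_at_inv \<phi> K (f i) (\<gamma>max i) (\<gamma>max i)) ` {1..n})"
    and "Min ((\<lambda>i. \<phi> * K * d i) ` {1..n}) < th 1"
    and "\<And>i. i \<in> {1..n} \<Longrightarrow> th i \<le> th (i + 1)"
    and "is_arg_max th
           (\<lambda>k. k \<in> {1..n} \<and>
              (\<Sum>i=1..k. g i (th k) - 1 / sqrt (K * deriv (f i) (g i (th k)))) \<le> \<phi> * lam)
           nstar"
    and "\<theta> \<in> {th nstar<..th (nstar + 1)}"
    and "\<And>i. i \<in> {1..n} \<Longrightarrow> \<gamma>opt i = (if i \<le> nstar then g i \<theta> else 0)"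
    and "\<And>i. i \<in> {1..n} \<Longrightarrow> uopt i =
           (if i \<le> nstar then \<gamma>opt i - sqrt (\<phi> * \<gamma>opt i / (\<theta> - K * \<phi> * f i (\<gamma>opt i))) else 0)"
    and "(\<Sum>i=1..n. uopt i) = \<phi> * lam"
  shows "optimal n lam \<phi> K f \<gamma>max uopt \<gamma>opt \<and>
    (\<forall>u \<gamma>. optimal n lam \<phi> K f \<gamma>max u \<gamma> \<longrightarrow>
       (\<forall>i\<in>{1..n}. u i = uopt i) \<and> (\<forall>i\<in>{1..nstar}. \<gamma> i = \<gamma>opt i))"
proof -
  have \<phi>: "\<phi> > 0" and lam: "lam > 0" using assms(2,3) by auto
  have node: "service_node K \<phi> (\<gamma>max i) (a i) (b i) (c i) (d i) (f i)" if "i \<in> {1..n}" for i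
    by unfold_locales (use that assms(4-10) \<phi> in auto)
  have nstar: "nstar \<in> {1..n}" using assms(16) by (simp add: is_arg_max_def)
  have mono: "th i \<le> th j" if "1 \<le> i" "i \<le> j" "j \<le> n + 1" for i j
    using that(2,3)
  proof (induction j rule: dec_induct)
    case (step k)
    then show ?case using assms(15)[of k] that(1) by auto
  qed simp
  \<comment> \<open>Since the prices are sorted, the interval containing \<open>\<theta>\<close>
    separates the nodes at \<open>nstar\<close>: cheaper ones are active, the others idle.\<close>
  have act: "th i < \<theta>" if "i \<in> {1..nstar}" for i
    using mono[of i nstar] that nstar assms(17) by auto
  have inact: "\<theta> \<le> th i" if "i \<in> {1..n}" "\<not> i \<le> nstar" for i
    using mono[of "nstar + 1" i] that assms(17) by auto
  define L where "L i u \<gamma> = u * (inverse (\<gamma> - u) + K * f i \<gamma> - \<theta> / \<phi>)" for i and u \<gamma> :: real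
  have nf: "node_feasible (\<gamma>max i) (uopt i) (\<gamma>opt i)" if i: "i \<in> {1..n}" for i
  proof (cases "i \<le> nstar")
    case True
    interpret service_node K \<phi> "\<gamma>max i" "a i" "b i" "c i" "d i" "f i" using node[OF i] .
    show ?thesis
      by (rule active_node_feasible[of \<theta>]) (use i True act[of i] assms(11,12,18,19)[OF i] in auto)
  next
    case False
    then show ?thesis
      using assms(18,19)[OF i] assms(5)[OF i] by (simp add: node_feasible_def)
  qed
  \<comment> \<open>With \<open>u = 0\<close> the value is 0 for every service rate, so for an idle
    node only a deviation in \<open>u\<close> is strictly worse.\<close>
  have less: "L i (uopt i) (\<gamma>opt i) < L i u \<gamma>"
    if i: "i \<in> {1..n}" and "node_feasible (\<gamma>max i) u \<gamma>" "u \<noteq> uopt i \<or> i \<le> nstar \<and> \<gamma> \<noteq> \<gamma>opt i"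
    for i u \<gamma>
  proof -
    interpret service_node K \<phi> "\<gamma>max i" "a i" "b i" "c i" "d i" "f i" using node[OF i] .
    have L: "L i = node_lagrangian \<theta>" by (simp add: L_def node_lagrangian_def fun_eq_iff)
    show ?thesis
    proof (cases "i \<le> nstar")
      case True
      show ?thesis unfolding L
        by (rule node_lagrangian_active)
          (use that True act[of i] assms(11,12,18,19)[OF i] in auto)
    next
      case False
      have "L i (uopt i) (\<gamma>opt i) = 0" using False assms(19)[OF i] by (simp add: L_def)
      then show ?thesis
        using node_lagrangian_inactive[of \<theta> u \<gamma>] that False inact[OF i] assms(12,19)[OF i]
        by (simp add: L)
    qed
  qed
  have le: "L i (uopt i) (\<gamma>opt i) \<le> L i u \<gamma>"
    if "i \<in> {1..n}" "node_feasible (\<gamma>max i) u \<gamma>" for i u \<gamma>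
  proof (cases "u \<noteq> uopt i \<or> i \<le> nstar \<and> \<gamma> \<noteq> \<gamma>opt i")
    case True
    then show ?thesis using less that less_imp_le by blast
  next
    case False
    \<comment> \<open>Here the values agree: either both rates coincide, or \<open>u\<close> and
      \<open>uopt i\<close> are both 0.\<close>
    then show ?thesis using assms(19)[OF that(1)] by (cases "i \<le> nstar") (auto simp: L_def)
  qed
  have feas: "feasible n lam \<phi> \<gamma>max (u, \<gamma>) \<longleftrightarrow>
      sum u {1..n} = \<phi> * lam \<and> (\<forall>i\<in>{1..n}. node_feasible (\<gamma>max i) (u i) (\<gamma> i))" for u \<gamma>
    by (simp add: feasible_def node_feasible_def)
  have feas_opt: "feasible n lam \<phi> \<gamma>max (uopt, \<gamma>opt)" using assms(20) nf by (simp add: feas)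
  \<comment> \<open>On the feasible set the multiplier term is constant, because the
    \<open>u i\<close> sum to \<open>\<phi> * lam\<close>; minimizing the cost is minimizing the sum
    of the node Lagrangians.\<close>
  have cost: "total_cost n lam K f (u, \<gamma>) = inverse lam * (\<Sum>i=1..n. L i (u i) (\<gamma> i)) + \<theta>"
    if "feasible n lam \<phi> \<gamma>max (u, \<gamma>)" for u \<gamma>
  proof -
    have "(\<Sum>i=1..n. u i * (inverse (\<gamma> i - u i) + K * f i (\<gamma> i))) =
        (\<Sum>i=1..n. L i (u i) (\<gamma> i) + \<theta> / \<phi> * u i)"
      by (intro sum.cong) (auto simp: L_def algebra_simps)
    also have "\<dots> = (\<Sum>i=1..n. L i (u i) (\<gamma> i)) + \<theta> / \<phi> * (\<phi> * lam)"
      using that unfolding feas by (simp only: sum.distrib sum_distrib_left[symmetric])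
    also have "\<theta> / \<phi> * (\<phi> * lam) = \<theta> * lam" using \<phi> by simp
    finally have "(\<Sum>i=1..n. u i * (inverse (\<gamma> i - u i) + K * f i (\<gamma> i))) =
        (\<Sum>i=1..n. L i (u i) (\<gamma> i)) + \<theta> * lam" .
    moreover have "total_cost n lam K f (u, \<gamma>) =
        inverse lam * (\<Sum>i=1..n. u i * (inverse (\<gamma> i - u i) + K * f i (\<gamma> i)))"
      unfolding total_cost_def by (simp only: prod.case sum_distrib_left mult.assoc)
    ultimately show ?thesis
      using lam by (simp only: distrib_left) simp
  qed
  have cost_le: "total_cost n lam K f (uopt, \<gamma>opt) \<le> total_cost n lam K f (u, \<gamma>)"
    if "feasible n lam \<phi> \<gamma>max (u, \<gamma>)" for u \<gamma>
  proof -
    have "(\<Sum>i=1..n. L i (uopt i) (\<gamma>opt i)) \<le> (\<Sum>i=1..n. L i (u i) (\<gamma> i))"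
      using that by (intro sum_mono le) (auto simp: feas)
    then show ?thesis using lam by (simp add: cost that feas_opt)
  qed
  have "optimal n lam \<phi> K f \<gamma>max uopt \<gamma>opt"
    using feas_opt cost_le by (auto simp: optimal_def is_arg_min_def not_less)
  moreover have "u i = uopt i \<and> (i \<le> nstar \<longrightarrow> \<gamma> i = \<gamma>opt i)"
    if opt: "optimal n lam \<phi> K f \<gamma>max u \<gamma>" and i: "i \<in> {1..n}" for u \<gamma> i
  proof (rule ccontr)
    assume neq: "\<not> (u i = uopt i \<and> (i \<le> nstar \<longrightarrow> \<gamma> i = \<gamma>opt i))"
    have fe: "feasible n lam \<phi> \<gamma>max (u, \<gamma>)"
      using opt by (simp add: optimal_def is_arg_min_def)
    \<comment> \<open>The weak inequality at every node is combined with the strict one at the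
      deviating node \<open>i\<close>.\<close>
    have "(\<Sum>i=1..n. L i (uopt i) (\<gamma>opt i)) < (\<Sum>i=1..n. L i (u i) (\<gamma> i))"
    proof (rule sum_strict_mono_ex1)
      show "\<forall>i\<in>{1..n}. L i (uopt i) (\<gamma>opt i) \<le> L i (u i) (\<gamma> i)"
        using fe le by (simp add: feas)
      show "\<exists>i\<in>{1..n}. L i (uopt i) (\<gamma>opt i) < L i (u i) (\<gamma> i)"
        using fe neq i by (intro bexI[of _ i] less) (auto simp: feas)
    qed simp
    then have "total_cost n lam K f (uopt, \<gamma>opt) < total_cost n lam K f (u, \<gamma>)"
      using lam by (simp add: cost fe feas_opt)
    then show False using opt feas_opt by (auto simp: optimal_def is_arg_min_def)
  qed
  ultimately show ?thesis using nstar by auto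
qed

end
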